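(* Let $C_1,C_2$ be subspaces of a $k$-vector space such that $(C_1,\Delta_1,\epsilon_1)$ and $(C_2,\Delta_2,\epsilon_2)$ are coassociative counital coalgebras, write $\Delta:=\Delta_1$, let $\Phi:C_1\to C_2$ be a channel map, and put $\mathbb{D}:=C_1+C_2$. Let $\delta_d,\hat\delta_d:\mathbb{D}\to\mathbb{D}^{\otimes2}$ be linear maps such that $\delta_d=\Delta$ on $C_1$, $\delta_d\Phi=(id\otimes\Phi)\Delta$, $\hat\delta_d=0$ on $C_1$ and $\hat\delta_d\Phi=(\Phi\otimes id)\Delta$. Then the coproduct $\bar\Delta:=\delta_d+\hat\delta_d$ is coassociative and $(\mathbb{D},\delta_d,\hat\delta_d)$ is a dendriform coalgebra.
   Context: $k$ is $\mathbb{R}$ or $\mathbb{C}$; all vector spaces have finite or countable dimension. Channel map: an invertible linear map $\Phi:C_1\to C_2$ that is a coalgebra morphism: $\Delta_2\Phi=(\Phi\otimes\Phi)\Delta_1$ and $\epsilon_2\Phi=\epsilon_1$. Dendriform coalgebra $(Z,\delta,\hat\delta)$: a vector space with linear maps $\delta,\hat\delta:Z\to Z^{\otimes2}$ such that 1. $(id\otimes(\delta+\hat\delta))\hat\delta=(\hat\delta\otimes id)\hat\delta$; 2. $(id\otimes\hat\delta)\delta=(\delta\otimes id)\hat\delta$; 3. $((\hat\delta+\delta)\otimes id)\delta=(id\otimes\delta)\delta$. The maps prescribed separately on $C_1$ and on $C_2$ are assumed to exist as linear maps on $C_1+C_2$ (automatic when $C_1\cap C_2=0$). *)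

theory Defs
  imports Complex_Main "HOL-Library.Function_Algebras" "HOL-Library.Countable_Set"
begin

text \<open>
  A vector space is a type with a scalar multiplication satisfying \<^locale>\<open>vector_space\<close>; the spaces
  of interest are subspaces of it, so linearity is relativised to a carrier set.
\<close>

definition linear_on ::
  "('k::field \<Rightarrow> 'a::ab_group_add \<Rightarrow> 'a) \<Rightarrow> ('k \<Rightarrow> 'b::ab_group_add \<Rightarrow> 'b) \<Rightarrow> 'a set \<Rightarrow> 'b set
    \<Rightarrow> ('a \<Rightarrow> 'b) \<Rightarrow> bool" where
  "linear_on s t A B f \<longleftrightarrow> f ` A \<subseteq> B \<and>
     (\<forall>x\<in>A. \<forall>y\<in>A. f (x + y) = f x + f y) \<and> (\<forall>c. \<forall>x\<in>A. f (s c x) = t c (f x))"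

definition bilinear_on ::
  "('k::field \<Rightarrow> 'a::ab_group_add \<Rightarrow> 'a) \<Rightarrow> ('k \<Rightarrow> 'b::ab_group_add \<Rightarrow> 'b) \<Rightarrow>
   ('k \<Rightarrow> 'c::ab_group_add \<Rightarrow> 'c) \<Rightarrow> 'a set \<Rightarrow> 'b set \<Rightarrow> 'c set \<Rightarrow> ('a \<Rightarrow> 'b \<Rightarrow> 'c) \<Rightarrow> bool" where
  "bilinear_on s t u A B U \<phi> \<longleftrightarrow>
     (\<forall>x\<in>A. linear_on t u B U (\<phi> x)) \<and> (\<forall>y\<in>B. linear_on s u A U (\<lambda>x. \<phi> x y))"

definition countable_dim ::
  "('k::field \<Rightarrow> 'a::ab_group_add \<Rightarrow> 'a) \<Rightarrow> 'a set \<Rightarrow> bool" where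
  "countable_dim s A \<longleftrightarrow> (\<exists>B. countable B \<and> module.span s B = A)"


section \<open>Tensor products\<close>

text \<open>
  The pure tensor of x and y is realised as the functional that evaluates a bilinear form at (x, y),
  and the tensor product as the span of the pure tensors. Over a field this is the usual algebraic
  tensor product, in any dimension: its universal property, with values in an arbitrary vector
  space, is \<open>tensor_universal\<close> below. With this model the tensor product of two subspaces
  is literally a subspace of the tensor product of the ambient spaces.
\<close>

type_synonym ('a, 'b, 'k) tensor = "('a \<Rightarrow> 'b \<Rightarrow> 'k) \<Rightarrow> 'k"

definition fun_scale :: "'k::field \<Rightarrow> ('x \<Rightarrow> 'k) \<Rightarrow> 'x \<Rightarrow> 'k" where
  "fun_scale c F = (\<lambda>x. c * F x)"

definition tens ::
  "('k::field \<Rightarrow> 'a::ab_group_add \<Rightarrow> 'a) \<Rightarrow> ('k \<Rightarrow> 'b::ab_group_add \<Rightarrow> 'b) \<Rightarrow> 'a \<Rightarrow> 'b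
    \<Rightarrow> ('a, 'b, 'k) tensor" where
  "tens s t x y = (\<lambda>\<beta>. if bilinear_on s t (*) UNIV UNIV UNIV \<beta> then \<beta> x y else 0)"

definition tensor_space ::
  "('k::field \<Rightarrow> 'a::ab_group_add \<Rightarrow> 'a) \<Rightarrow> ('k \<Rightarrow> 'b::ab_group_add \<Rightarrow> 'b) \<Rightarrow> 'a set \<Rightarrow> 'b set
    \<Rightarrow> ('a, 'b, 'k) tensor set" where
  "tensor_space s t A B = module.span fun_scale {tens s t x y | x y. x \<in> A \<and> y \<in> B}"

lemma vector_space_fun_scale: "vector_space (fun_scale :: 'k::field \<Rightarrow> ('x \<Rightarrow> 'k) \<Rightarrow> 'x \<Rightarrow> 'k)"
  by standard (auto simp: fun_scale_def fun_eq_iff algebra_simps)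

lemma vector_space_mult: "vector_space ((*) :: 'k::field \<Rightarrow> 'k \<Rightarrow> 'k)"
  by standard (auto simp: algebra_simps)

lemma separating_functional:
  assumes "vector_space s" "x \<noteq> 0"
  obtains f where "Vector_Spaces.linear s (*) f" "f x = (1::'k::field)"
proof -
  interpret vector_space_pair s "(*) :: 'k \<Rightarrow> 'k \<Rightarrow> 'k"
    using assms(1) vector_space_mult by (simp add: vector_space_pair_def)
  have i: "vs1.independent {x}" using assms(2) by (simp add: vs1.dependent_single)
  show thesis
    using that[OF linear_construct[OF i, of "\<lambda>_. 1"]] construct_basis[OF i, of x "\<lambda>_. 1"] by simp
qed

lemma linear_projection:
  assumes "vector_space s" "module.subspace s A"
  obtains p where "Vector_Spaces.linear s s p" "p ` UNIV \<subseteq> A" "\<And>x. x \<in> A \<Longrightarrow> p x = x"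
proof -
  interpret vector_space_pair s s using assms(1) by (simp add: vector_space_pair_def)
  have "Vector_Spaces.linear s s id" by (rule vs1.linear_id)
  from linear_exists_left_inverse_on[OF this assms(2)] show thesis
    using that by auto
qed

theorem tensor_universal:
  fixes s :: "'k::field \<Rightarrow> 'a::ab_group_add \<Rightarrow> 'a" and t :: "'k \<Rightarrow> 'b::ab_group_add \<Rightarrow> 'b"
    and u :: "'k \<Rightarrow> 'c::ab_group_add \<Rightarrow> 'c"
  assumes vs: "vector_space s" "vector_space t" "vector_space u"
    and A: "module.subspace s A" and B: "module.subspace t B" and U: "module.subspace u U"
    and phi: "bilinear_on s t u A B U \<phi>"
  shows "\<exists>h. linear_on fun_scale u (tensor_space s t A B) U h \<and>
    (\<forall>x\<in>A. \<forall>y\<in>B. h (tens s t x y) = \<phi> x y) \<and>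
    (\<forall>h'. linear_on fun_scale u (tensor_space s t A B) U h' \<longrightarrow>
       (\<forall>x\<in>A. \<forall>y\<in>B. h' (tens s t x y) = \<phi> x y) \<longrightarrow> (\<forall>w\<in>tensor_space s t A B. h' w = h w))"
proof -
  interpret S: vector_space s by fact
  interpret T: vector_space t by fact
  interpret V: vector_space u by fact
  interpret FV: vector_space_pair "fun_scale :: 'k \<Rightarrow> ('a, 'b, 'k) tensor \<Rightarrow> ('a, 'b, 'k) tensor" u
    using vs(3) vector_space_fun_scale by (simp add: vector_space_pair_def)
  obtain p where p: "Vector_Spaces.linear s s p" "p ` UNIV \<subseteq> A" "\<And>x. x \<in> A \<Longrightarrow> p x = x"
    using linear_projection[OF vs(1) A] by blast
  obtain q where q: "Vector_Spaces.linear t t q" "q ` UNIV \<subseteq> B" "\<And>x. x \<in> B \<Longrightarrow> q x = x"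
    using linear_projection[OF vs(2) B] by blast
  interpret p: Vector_Spaces.linear s s p by fact
  interpret q: Vector_Spaces.linear t t q by fact
  define \<psi> where "\<psi> x y = \<phi> (p x) (q y)" for x y
  have pin: "p x \<in> A" and qin: "q y \<in> B" for x y using p(2) q(2) by auto
  have psi: "\<psi> x (y + y') = \<psi> x y + \<psi> x y'" "\<psi> (x + x') y = \<psi> x y + \<psi> x' y"
    "\<psi> x (t c y) = u c (\<psi> x y)" "\<psi> (s c x) y = u c (\<psi> x y)" for x x' y y' c
    using phi pin qin
    by (auto simp: \<psi>_def bilinear_on_def linear_on_def p.add q.add p.scale q.scale)
  define P where "P = {tens s t x y | x y. True}"
  obtain I where I: "I \<subseteq> P" "FV.vs1.independent I" "P \<subseteq> FV.vs1.span I"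
    using FV.vs1.maximal_independent_subset[of P] by metis
  have "\<forall>b\<in>I. \<exists>x y. b = tens s t x y" using I(1) by (auto simp: P_def)
  then obtain X Y where XY: "\<And>b. b \<in> I \<Longrightarrow> b = tens s t (X b) (Y b)" by metis
  define h where "h = FV.construct I (\<lambda>b. \<psi> (X b) (Y b))"
  have hlin: "Vector_Spaces.linear fun_scale u h"
    unfolding h_def by (rule FV.linear_construct[OF I(2)])
  interpret h: Vector_Spaces.linear fun_scale u h by fact
  have eval: "f (h w) = w (\<lambda>x y. f (\<psi> x y))" if f: "Vector_Spaces.linear u (*) f"
    and w: "w \<in> FV.vs1.span I" for f w
  proof -
    interpret f: Vector_Spaces.linear u "(*)" f by fact
    have bil: "bilinear_on s t (*) UNIV UNIV UNIV (\<lambda>x y. f (\<psi> x y))"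
      by (auto simp: bilinear_on_def linear_on_def psi f.add f.scale)
    show ?thesis using w
    proof (induction rule: FV.vs1.span_induct_alt)
      case base
      show ?case by (subst h.zero) (simp add: f.zero)
    next
      case (step c b w)
      have "f (h b) = b (\<lambda>x y. f (\<psi> x y))"
      proof -
        have "h b = \<psi> (X b) (Y b)" unfolding h_def by (rule FV.construct_basis[OF I(2) step(1)])
        moreover have "b (\<lambda>x y. f (\<psi> x y)) = tens s t (X b) (Y b) (\<lambda>x y. f (\<psi> x y))"
          using XY[OF step(1)] by (rule arg_cong)
        ultimately show ?thesis using bil by (simp add: tens_def)
      qed
      then have "f (h (fun_scale c b + w)) = c * b (\<lambda>x y. f (\<psi> x y)) + w (\<lambda>x y. f (\<psi> x y))"
        using step by (simp only: h.add h.scale f.add f.scale)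
      then show ?case by (rule trans) (simp add: fun_scale_def)
    qed
  qed
  have hpure: "h (tens s t x y) = \<psi> x y" for x y
  proof (rule ccontr)
    assume "h (tens s t x y) \<noteq> \<psi> x y"
    then have "h (tens s t x y) - \<psi> x y \<noteq> 0" by simp
    then obtain f where f: "Vector_Spaces.linear u (*) f" "f (h (tens s t x y) - \<psi> x y) = 1"
      using separating_functional[OF vs(3)] by blast
    interpret f: Vector_Spaces.linear u "(*)" f by fact
    have bil: "bilinear_on s t (*) UNIV UNIV UNIV (\<lambda>x y. f (\<psi> x y))"
      by (auto simp: bilinear_on_def linear_on_def psi f.add f.scale)
    have "tens s t x y \<in> FV.vs1.span I" using I(3) by (auto simp: P_def)
    from eval[OF f(1) this] bil have "f (h (tens s t x y)) = f (\<psi> x y)" by (simp add: tens_def)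
    with f(2) show False by (simp add: f.diff)
  qed
  have hAB: "h (tens s t x y) = \<phi> x y" if "x \<in> A" "y \<in> B" for x y
    using that by (simp add: hpure \<psi>_def p(3) q(3))
  have hU: "h w \<in> U" if "w \<in> tensor_space s t A B" for w
    using that unfolding tensor_space_def
  proof (induction rule: FV.vs1.span_induct_alt)
    case base
    show ?case using V.subspace_0[OF U] by (simp only: h.zero)
  next
    case (step c b w)
    then obtain x y where xy: "b = tens s t x y" "x \<in> A" "y \<in> B" by blast
    then have "\<phi> x y \<in> U" using phi unfolding bilinear_on_def linear_on_def by blast
    then have "h b \<in> U" using hAB xy by simp
    then show ?case unfolding h.add h.scale using step U
      by (intro V.subspace_add V.subspace_scale)
  qed
  have 1: "linear_on fun_scale u (tensor_space s t A B) U h"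
    unfolding linear_on_def h.add h.scale using hU by blast
  have "h' w = h w" if h': "linear_on fun_scale u (tensor_space s t A B) U h'"
    "\<forall>x\<in>A. \<forall>y\<in>B. h' (tens s t x y) = \<phi> x y" and w: "w \<in> tensor_space s t A B" for h' w
  proof -
    have "w \<in> tensor_space s t A B \<and> h' w = h w" using w unfolding tensor_space_def
    proof (induction rule: FV.vs1.span_induct_alt)
      case base
      have "(0::('a, 'b, 'k) tensor) \<in> tensor_space s t A B"
        unfolding tensor_space_def by (rule FV.vs1.span_zero)
      then have "h' (fun_scale 0 0) = u 0 (h' 0)" using h'(1) unfolding linear_on_def by blast
      then have "h' 0 = h 0" by (simp only: h.zero FV.vs1.scale_zero_left V.scale_zero_left)
      then show ?case using FV.vs1.span_zero by blast
    next
      case (step c b w)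
      then obtain x y where xy: "b = tens s t x y" "x \<in> A" "y \<in> B" by blast
      have b: "b \<in> tensor_space s t A B"
        unfolding tensor_space_def using step(1) by (rule FV.vs1.span_base)
      have cb: "fun_scale c b \<in> tensor_space s t A B"
        using b unfolding tensor_space_def by (rule FV.vs1.span_scale)
      have w: "w \<in> tensor_space s t A B" "h' w = h w"
        using step unfolding tensor_space_def by auto
      have "h' (fun_scale c b + w) = u c (h' b) + h' w"
        using h'(1) b cb w(1) unfolding linear_on_def by metis
      also have "\<dots> = h (fun_scale c b + w)"
        unfolding h.add h.scale using h'(2) hAB xy w(2) by simp
      finally show ?case
        using cb w(1) unfolding tensor_space_def by (blast intro: FV.vs1.span_add)
    qed
    then show ?thesis by simp
  qed
  with 1 hAB show ?thesis by blast
qed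

text \<open>The linear map on the tensor product of A and B that a bilinear map induces; its values
  outside the tensor product are unspecified.\<close>

definition tensor_lift ::
  "('k::field \<Rightarrow> 'a::ab_group_add \<Rightarrow> 'a) \<Rightarrow> ('k \<Rightarrow> 'b::ab_group_add \<Rightarrow> 'b) \<Rightarrow>
   ('k \<Rightarrow> 'c::ab_group_add \<Rightarrow> 'c) \<Rightarrow> 'a set \<Rightarrow> 'b set \<Rightarrow> ('a \<Rightarrow> 'b \<Rightarrow> 'c)
    \<Rightarrow> ('a, 'b, 'k) tensor \<Rightarrow> 'c" where
  "tensor_lift s t u A B \<phi> = (SOME h. linear_on fun_scale u (tensor_space s t A B) UNIV h \<and>
     (\<forall>x\<in>A. \<forall>y\<in>B. h (tens s t x y) = \<phi> x y))"

lemma tensor_lift: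
  assumes "vector_space s" "vector_space t" "vector_space u"
    and "module.subspace s A" "module.subspace t B" and "bilinear_on s t u A B UNIV \<phi>"
  shows "linear_on fun_scale u (tensor_space s t A B) UNIV (tensor_lift s t u A B \<phi>)"
    and "x \<in> A \<Longrightarrow> y \<in> B \<Longrightarrow> tensor_lift s t u A B \<phi> (tens s t x y) = \<phi> x y"
proof -
  have "module.subspace u UNIV"
    using assms(3) by (simp add: module.subspace_UNIV module_iff_vector_space)
  from someI_ex[of "\<lambda>h. linear_on fun_scale u (tensor_space s t A B) UNIV h \<and>
     (\<forall>x\<in>A. \<forall>y\<in>B. h (tens s t x y) = \<phi> x y)"] tensor_universal[OF assms(1-5) this assms(6)]
  have "linear_on fun_scale u (tensor_space s t A B) UNIV (tensor_lift s t u A B \<phi>) \<and>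
     (\<forall>x\<in>A. \<forall>y\<in>B. tensor_lift s t u A B \<phi> (tens s t x y) = \<phi> x y)"
    unfolding tensor_lift_def by blast
  then show "linear_on fun_scale u (tensor_space s t A B) UNIV (tensor_lift s t u A B \<phi>)"
    "x \<in> A \<Longrightarrow> y \<in> B \<Longrightarrow> tensor_lift s t u A B \<phi> (tens s t x y) = \<phi> x y" by auto
qed

text \<open>The map f \<open>\<otimes>\<close> g on the tensor product of A and B; s, t are the scalar multiplications of the
  sources and s', t' those of the targets.\<close>

definition tensor_map ::
  "('k::field \<Rightarrow> 'a::ab_group_add \<Rightarrow> 'a) \<Rightarrow> ('k \<Rightarrow> 'b::ab_group_add \<Rightarrow> 'b) \<Rightarrow>
   ('k \<Rightarrow> 'c::ab_group_add \<Rightarrow> 'c) \<Rightarrow> ('k \<Rightarrow> 'd::ab_group_add \<Rightarrow> 'd) \<Rightarrow> 'a set \<Rightarrow> 'b set \<Rightarrow>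
   ('a \<Rightarrow> 'c) \<Rightarrow> ('b \<Rightarrow> 'd) \<Rightarrow> ('a, 'b, 'k) tensor \<Rightarrow> ('c, 'd, 'k) tensor" where
  "tensor_map s t s' t' A B f g = tensor_lift s t fun_scale A B (\<lambda>x y. tens s' t' (f x) (g y))"

text \<open>f \<open>\<otimes>\<close> id and id \<open>\<otimes>\<close> f on Z \<open>\<otimes>\<close> Z, where f takes values in a space with scalar
  multiplication t.\<close>

abbreviation map_id ::
  "('k::field \<Rightarrow> 'a::ab_group_add \<Rightarrow> 'a) \<Rightarrow> ('k \<Rightarrow> 'c::ab_group_add \<Rightarrow> 'c) \<Rightarrow> 'a set \<Rightarrow>
   ('a \<Rightarrow> 'c) \<Rightarrow> ('a, 'a, 'k) tensor \<Rightarrow> ('c, 'a, 'k) tensor" where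
  "map_id s t Z f \<equiv> tensor_map s s t s Z Z f id"

abbreviation id_map ::
  "('k::field \<Rightarrow> 'a::ab_group_add \<Rightarrow> 'a) \<Rightarrow> ('k \<Rightarrow> 'c::ab_group_add \<Rightarrow> 'c) \<Rightarrow> 'a set \<Rightarrow>
   ('a \<Rightarrow> 'c) \<Rightarrow> ('a, 'a, 'k) tensor \<Rightarrow> ('a, 'c, 'k) tensor" where
  "id_map s t Z f \<equiv> tensor_map s s s t Z Z id f"

text \<open>The canonical identification of (Z \<open>\<otimes>\<close> Z) \<open>\<otimes>\<close> Z with Z \<open>\<otimes>\<close> (Z \<open>\<otimes>\<close> Z).\<close>

definition tensor_assoc ::
  "('k::field \<Rightarrow> 'a::ab_group_add \<Rightarrow> 'a) \<Rightarrow> 'a set \<Rightarrow>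
   (('a, 'a, 'k) tensor, 'a, 'k) tensor \<Rightarrow> ('a, ('a, 'a, 'k) tensor, 'k) tensor" where
  "tensor_assoc s Z = tensor_lift fun_scale s fun_scale (tensor_space s s Z Z) Z
     (\<lambda>w z. tensor_lift s s fun_scale Z Z (\<lambda>x y. tens s fun_scale x (tens s s y z)) w)"


section \<open>Coalgebras, channel maps, dendriform coalgebras\<close>

definition coassociative ::
  "('k::field \<Rightarrow> 'a::ab_group_add \<Rightarrow> 'a) \<Rightarrow> 'a set \<Rightarrow> ('a \<Rightarrow> ('a, 'a, 'k) tensor) \<Rightarrow> bool" where
  "coassociative s Z \<Delta> \<longleftrightarrow>
     (\<forall>z\<in>Z. id_map s fun_scale Z \<Delta> (\<Delta> z) = tensor_assoc s Z (map_id s fun_scale Z \<Delta> (\<Delta> z)))"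

text \<open>The counit laws are stated in k \<open>\<otimes>\<close> C and C \<open>\<otimes>\<close> k, where c corresponds to the pure
  tensor of 1 and c, respectively of c and 1.\<close>

definition coalgebra ::
  "('k::field \<Rightarrow> 'a::ab_group_add \<Rightarrow> 'a) \<Rightarrow> 'a set \<Rightarrow> ('a \<Rightarrow> ('a, 'a, 'k) tensor) \<Rightarrow> ('a \<Rightarrow> 'k)
    \<Rightarrow> bool" where
  "coalgebra s C \<Delta> \<epsilon> \<longleftrightarrow> module.subspace s C \<and>
     linear_on s fun_scale C (tensor_space s s C C) \<Delta> \<and> linear_on s (*) C UNIV \<epsilon> \<and>
     coassociative s C \<Delta> \<and>
     (\<forall>c\<in>C. map_id s (*) C \<epsilon> (\<Delta> c) = tens (*) s 1 c) \<and>
     (\<forall>c\<in>C. id_map s (*) C \<epsilon> (\<Delta> c) = tens s (*) c 1)"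

definition channel_map ::
  "('k::field \<Rightarrow> 'a::ab_group_add \<Rightarrow> 'a) \<Rightarrow>
   'a set \<Rightarrow> ('a \<Rightarrow> ('a, 'a, 'k) tensor) \<Rightarrow> ('a \<Rightarrow> 'k) \<Rightarrow>
   'a set \<Rightarrow> ('a \<Rightarrow> ('a, 'a, 'k) tensor) \<Rightarrow> ('a \<Rightarrow> 'k) \<Rightarrow> ('a \<Rightarrow> 'a) \<Rightarrow> bool" where
  "channel_map s C\<^sub>1 \<Delta>\<^sub>1 \<epsilon>\<^sub>1 C\<^sub>2 \<Delta>\<^sub>2 \<epsilon>\<^sub>2 \<Phi> \<longleftrightarrow>
     linear_on s s C\<^sub>1 C\<^sub>2 \<Phi> \<and> bij_betw \<Phi> C\<^sub>1 C\<^sub>2 \<and>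
     (\<forall>c\<in>C\<^sub>1. \<Delta>\<^sub>2 (\<Phi> c) = tensor_map s s s s C\<^sub>1 C\<^sub>1 \<Phi> \<Phi> (\<Delta>\<^sub>1 c)) \<and>
     (\<forall>c\<in>C\<^sub>1. \<epsilon>\<^sub>2 (\<Phi> c) = \<epsilon>\<^sub>1 c)"

definition dendriform_coalgebra ::
  "('k::field \<Rightarrow> 'a::ab_group_add \<Rightarrow> 'a) \<Rightarrow> 'a set \<Rightarrow> ('a \<Rightarrow> ('a, 'a, 'k) tensor) \<Rightarrow>
   ('a \<Rightarrow> ('a, 'a, 'k) tensor) \<Rightarrow> bool" where
  "dendriform_coalgebra s Z \<delta> \<delta>' \<longleftrightarrow> module.subspace s Z \<and>
     linear_on s fun_scale Z (tensor_space s s Z Z) \<delta> \<and>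
     linear_on s fun_scale Z (tensor_space s s Z Z) \<delta>' \<and>
     (\<forall>z\<in>Z. id_map s fun_scale Z (\<lambda>x. \<delta> x + \<delta>' x) (\<delta>' z)
            = tensor_assoc s Z (map_id s fun_scale Z \<delta>' (\<delta>' z))) \<and>
     (\<forall>z\<in>Z. id_map s fun_scale Z \<delta>' (\<delta> z)
            = tensor_assoc s Z (map_id s fun_scale Z \<delta> (\<delta>' z))) \<and>
     (\<forall>z\<in>Z. tensor_assoc s Z (map_id s fun_scale Z (\<lambda>x. \<delta>' x + \<delta> x) (\<delta> z))
            = id_map s fun_scale Z \<delta> (\<delta> z))"

text \<open>
  The class \<^class>\<open>real_normed_field\<close> is how the theorem expresses that k is the field of real or
  complex numbers: both are instances and, by the Gelfand-Mazur theorem, every instance is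
  isomorphic to one of them.
\<close>

end

theory Submission
  imports Defs
begin

text \<open>
  By linearity it suffices to check each axiom on \<open>c\<close> and on \<open>\<Phi> c\<close> with \<open>c \<in> C\<^sub>1\<close>. There
  both sides either vanish or are \<open>(f \<otimes> g \<otimes> h)(c\<^sub>1 \<otimes> c\<^sub>2 \<otimes> c\<^sub>3)\<close> with \<open>(f, g, h)\<close> one of
  \<open>(\<Phi>, id, id)\<close>, \<open>(id, \<Phi>, id)\<close>, \<open>(id, id, \<Phi>)\<close> and \<open>(id, id, id)\<close>, so the axioms
  reduce to coassociativity of \<open>\<Delta>\<^sub>1\<close>. The sum of the three axioms is coassociativity of
  \<open>\<delta> + \<delta>'\<close>.
\<close>

text \<open>A tensor is a function, and the simplifier would otherwise turn a sum of tensors under a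
  linear map into a lambda abstraction.\<close>

declare plus_fun_apply [simp del] zero_fun_apply [simp del]

section \<open>Linear maps on a carrier set\<close>

lemma linear_on_in: "linear_on s t A B f \<Longrightarrow> x \<in> A \<Longrightarrow> f x \<in> B"
  by (auto simp: linear_on_def)

lemma linear_on_plus: "linear_on s t A B f \<Longrightarrow> x \<in> A \<Longrightarrow> y \<in> A \<Longrightarrow> f (x + y) = f x + f y"
  by (auto simp: linear_on_def)

lemma linear_on_mono: "linear_on s t A B f \<Longrightarrow> A' \<subseteq> A \<Longrightarrow> B \<subseteq> B' \<Longrightarrow> linear_on s t A' B' f"
  unfolding linear_on_def by blast

text \<open>Closure of \<open>A\<close> under sums and scaling transfers the laws, since
  \<open>f\<close> and \<open>g\<close> are known to agree only inside \<open>A\<close>.\<close>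

lemma linear_on_cong:
  assumes "linear_on s t A B f" "\<And>x. x \<in> A \<Longrightarrow> f x = g x"
    and "vector_space s" "module.subspace s A"
  shows "linear_on s t A B g"
proof -
  interpret vector_space s by fact
  show ?thesis
    using assms(1,2) subspace_add[OF assms(4)] subspace_scale[OF assms(4)]
    by (auto simp: linear_on_def image_subset_iff)
qed

lemma linear_on_id: "A \<subseteq> B \<Longrightarrow> linear_on s s A B id"
  by (auto simp: linear_on_def)

lemma linear_on_compose:
  "linear_on s t A B f \<Longrightarrow> linear_on t u B C g \<Longrightarrow> linear_on s u A C (\<lambda>x. g (f x))"
  by (auto simp: linear_on_def image_subset_iff)

lemma linear_on_zero:
  assumes "linear_on s t A B f" "0 \<in> A"
  shows "f 0 = 0"
  using linear_on_plus[OF assms(1,2,2)] by simp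

lemma linear_on_add:
  assumes "vector_space t" "module.subspace t B"
    and "linear_on s t A B f" "linear_on s t A B g"
  shows "linear_on s t A B (\<lambda>x. f x + g x)"
proof -
  interpret vector_space t by fact
  show ?thesis
    using assms(3,4) subspace_add[OF assms(2)]
    by (auto simp: linear_on_def image_subset_iff scale_right_distrib algebra_simps)
qed

section \<open>Tensor spaces and their pure tensors\<close>

lemma subspace_tensor_space:
  fixes s :: "'k::field \<Rightarrow> 'a::ab_group_add \<Rightarrow> 'a" and t :: "'k \<Rightarrow> 'b::ab_group_add \<Rightarrow> 'b"
  shows "module.subspace fun_scale (tensor_space s t A B)"
proof -
  interpret vector_space "fun_scale :: 'k \<Rightarrow> ('a, 'b, 'k) tensor \<Rightarrow> ('a, 'b, 'k) tensor"
    by (rule vector_space_fun_scale)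
  show ?thesis unfolding tensor_space_def by (rule subspace_span)
qed

lemma tensor_space_add:
  "w \<in> tensor_space s t A B \<Longrightarrow> w' \<in> tensor_space s t A B \<Longrightarrow> w + w' \<in> tensor_space s t A B"
  using module.subspace_add[OF _ subspace_tensor_space]
  by (metis module_iff_vector_space vector_space_fun_scale)

lemma tensor_space_0: "0 \<in> tensor_space s t A B"
  using module.subspace_0[OF _ subspace_tensor_space]
  by (metis module_iff_vector_space vector_space_fun_scale)

lemma tens_in_tensor_space:
  fixes s :: "'k::field \<Rightarrow> 'a::ab_group_add \<Rightarrow> 'a" and t :: "'k \<Rightarrow> 'b::ab_group_add \<Rightarrow> 'b"
  assumes "x \<in> A" "y \<in> B"
  shows "tens s t x y \<in> tensor_space s t A B"
proof -
  interpret vector_space "fun_scale :: 'k \<Rightarrow> ('a, 'b, 'k) tensor \<Rightarrow> ('a, 'b, 'k) tensor"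
    by (rule vector_space_fun_scale)
  show ?thesis unfolding tensor_space_def using assms by (intro span_base) blast
qed

text \<open>Evaluate at a form \<open>\<beta>\<close>: a bilinear one passes its own law on, and at
  any other form both sides are 0. The next three laws hold for the same reason.\<close>

lemma tens_add_left: "tens s t (x + x') y = tens s t x y + tens s t x' y"
  by (auto simp: tens_def fun_eq_iff bilinear_on_def linear_on_def plus_fun_apply)

lemma tens_add_right: "tens s t x (y + y') = tens s t x y + tens s t x y'"
  by (auto simp: tens_def fun_eq_iff bilinear_on_def linear_on_def plus_fun_apply)

lemma tens_scale_left: "tens s t (s c x) y = fun_scale c (tens s t x y)"
  by (auto simp: tens_def fun_eq_iff bilinear_on_def linear_on_def fun_scale_def)

lemma tens_scale_right: "tens s t x (t c y) = fun_scale c (tens s t x y)"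
  by (auto simp: tens_def fun_eq_iff bilinear_on_def linear_on_def fun_scale_def)

lemma tens_zero_right: "tens s t x 0 = 0"
  using tens_add_right[of s t x 0 0] by simp

text \<open>A scalar coefficient can be absorbed into the left factor of a pure tensor, so induction
  over linear combinations needs only sums of pure tensors and no scaling case.\<close>

lemma tensor_induct [consumes 3, case_names pure add zero]:
  fixes s :: "'k::field \<Rightarrow> 'a::ab_group_add \<Rightarrow> 'a" and t :: "'k \<Rightarrow> 'b::ab_group_add \<Rightarrow> 'b"
  assumes "vector_space s" "module.subspace s A"
    and "w \<in> tensor_space s t A B"
    and pure: "\<And>x y. x \<in> A \<Longrightarrow> y \<in> B \<Longrightarrow> P (tens s t x y)"
    and add: "\<And>w w'. w \<in> tensor_space s t A B \<Longrightarrow> w' \<in> tensor_space s t A B \<Longrightarrow>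
      P w \<Longrightarrow> P w' \<Longrightarrow> P (w + w')"
    and zero: "P 0"
  shows "P w"
proof -
  interpret S: vector_space s by fact
  interpret F: vector_space "fun_scale :: 'k \<Rightarrow> ('a, 'b, 'k) tensor \<Rightarrow> ('a, 'b, 'k) tensor"
    by (rule vector_space_fun_scale)
  \<comment> \<open>Membership is carried along because \<open>add\<close> demands it of both
    summands.\<close>
  have "w \<in> tensor_space s t A B \<and> P w"
    using assms(3) unfolding tensor_space_def
  proof (induction rule: F.span_induct_alt)
    case base
    show ?case using zero F.span_zero by blast
  next
    case (step c b w)
    then obtain x y where xy: "b = tens s t x y" "x \<in> A" "y \<in> B" by blast
    have "s c x \<in> A" by (rule S.subspace_scale) (fact assms(2) xy(2))+
    then have "fun_scale c b \<in> tensor_space s t A B" "P (fun_scale c b)"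
      using pure xy tens_in_tensor_space by (simp_all flip: tens_scale_left)
    with step show ?case
      unfolding tensor_space_def by (blast intro: F.span_add add[unfolded tensor_space_def])
  qed
  then show ?thesis ..
qed

text \<open>Pure tensors generate the space additively. \<open>U\<close> and \<open>V\<close> may
  differ, so a map into \<open>UNIV\<close> can be compared with one into a tensor space.\<close>

lemma tensor_eqI:
  assumes "vector_space s" "module.subspace s A"
    and "linear_on fun_scale u (tensor_space s t A B) U f"
    and "linear_on fun_scale u (tensor_space s t A B) V g"
    and "\<And>x y. x \<in> A \<Longrightarrow> y \<in> B \<Longrightarrow> f (tens s t x y) = g (tens s t x y)"
    and "w \<in> tensor_space s t A B"
  shows "f w = g w"
  using assms(1,2,6)
proof (induction rule: tensor_induct)
  case (add w w')
  then show ?case using linear_on_plus[OF assms(3)] linear_on_plus[OF assms(4)] by simp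
next
  case zero
  show ?case
    using linear_on_zero[OF assms(3) tensor_space_0] linear_on_zero[OF assms(4) tensor_space_0]
    by simp
qed (fact assms(5))

section \<open>The maps \<open>f \<otimes> g\<close>: linearity and functoriality\<close>

lemma bilinear_on_tens:
  assumes "linear_on s s' A A' f" "linear_on t t' B B' g"
  shows "bilinear_on s t fun_scale A B UNIV (\<lambda>x y. tens s' t' (f x) (g y))"
  using assms
  by (auto simp: bilinear_on_def linear_on_def tens_add_left tens_add_right tens_scale_left
      tens_scale_right)

lemma tensor_map_tens:
  assumes "vector_space s" "vector_space t" "module.subspace s A" "module.subspace t B"
    and "linear_on s s' A A' f" "linear_on t t' B B' g" "x \<in> A" "y \<in> B"
  shows "tensor_map s t s' t' A B f g (tens s t x y) = tens s' t' (f x) (g y)"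
  unfolding tensor_map_def
  using tensor_lift(2)[OF assms(1,2) vector_space_fun_scale assms(3,4) bilinear_on_tens[OF assms(5,6)]
    assms(7,8)] .

text \<open>The lift is only known to be linear into \<open>UNIV\<close>. The narrower target
  follows by induction, as pure tensors go to pure tensors with factors in \<open>A'\<close> and
  \<open>B'\<close>.\<close>

lemma linear_on_tensor_map:
  assumes "vector_space s" "vector_space t" "module.subspace s A" "module.subspace t B"
    and "linear_on s s' A A' f" "linear_on t t' B B' g"
  shows "linear_on fun_scale fun_scale (tensor_space s t A B) (tensor_space s' t' A' B')
    (tensor_map s t s' t' A B f g)"
proof -
  have lin: "linear_on fun_scale fun_scale (tensor_space s t A B) UNIV
      (tensor_map s t s' t' A B f g)"
    unfolding tensor_map_def
    by (rule tensor_lift(1)[OF assms(1,2) vector_space_fun_scale assms(3,4)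
          bilinear_on_tens[OF assms(5,6)]])
  have "tensor_map s t s' t' A B f g w \<in> tensor_space s' t' A' B'"
    if "w \<in> tensor_space s t A B" for w
    using assms(1,3) that
  proof (induction rule: tensor_induct)
    case (pure x y)
    then show ?case
      using tensor_map_tens[OF assms pure] linear_on_in[OF assms(5)] linear_on_in[OF assms(6)]
      by (simp add: tens_in_tensor_space)
  next
    case (add w w')
    then show ?case using linear_on_plus[OF lin] by (simp add: tensor_space_add)
  next
    case zero
    show ?case using linear_on_zero[OF lin tensor_space_0] by (simp add: tensor_space_0)
  qed
  with lin show ?thesis by (auto simp: linear_on_def)
qed

text \<open>\<open>tensor_map\<close> rests on a choice, so changing \<open>f\<close> or
  \<open>g\<close> off the carriers may change the map outside the tensor space. Inside it, both
  choices are linear and agree on pure tensors.\<close>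

lemma tensor_map_cong:
  assumes "vector_space s" "vector_space t" "module.subspace s A" "module.subspace t B"
    and "linear_on s s' A A' f" "linear_on t t' B B' g"
    and eq: "\<And>x. x \<in> A \<Longrightarrow> f x = f' x" "\<And>y. y \<in> B \<Longrightarrow> g y = g' y"
    and w: "w \<in> tensor_space s t A B"
  shows "tensor_map s t s' t' A B f g w = tensor_map s t s' t' A B f' g' w"
proof -
  have lin: "linear_on s s' A A' f'" "linear_on t t' B B' g'"
    using eq by (auto intro: linear_on_cong[OF assms(5) _ assms(1,3)] linear_on_cong[OF assms(6) _ assms(2,4)])
  show ?thesis
    by (rule tensor_eqI[OF assms(1,3) linear_on_tensor_map[OF assms(1-6)]
          linear_on_tensor_map[OF assms(1-4) lin] _ w])
      (simp add: tensor_map_tens[OF assms(1-6)] tensor_map_tens[OF assms(1-4) lin] eq)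
qed

lemma tensor_map_compose:
  assumes "vector_space s" "vector_space t" "module.subspace s A" "module.subspace t B"
    and f: "linear_on s s' A A' f" and g: "linear_on t t' B B' g"
    and "vector_space s'" "vector_space t'" "module.subspace s' A'" "module.subspace t' B'"
    and f': "linear_on s' s'' A' A'' f'" and g': "linear_on t' t'' B' B'' g'"
    and w: "w \<in> tensor_space s t A B"
  shows "tensor_map s' t' s'' t'' A' B' f' g' (tensor_map s t s' t' A B f g w) =
    tensor_map s t s'' t'' A B (\<lambda>x. f' (f x)) (\<lambda>y. g' (g y)) w"
proof -
  note ff = linear_on_compose[OF f f'] and gg = linear_on_compose[OF g g']
  note l = linear_on_tensor_map[OF assms(1-6)] and l' = linear_on_tensor_map[OF assms(7-12)]
  show ?thesis
    by (rule tensor_eqI[OF assms(1,3) linear_on_compose[OF l l']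
          linear_on_tensor_map[OF assms(1-4) ff gg] _ w])
      (simp add: tensor_map_tens[OF assms(1-6)] tensor_map_tens[OF assms(7-12)]
        tensor_map_tens[OF assms(1-4) ff gg] linear_on_in[OF f] linear_on_in[OF g])
qed

lemma tensor_map_id:
  assumes "vector_space s" "vector_space t" "module.subspace s A" "module.subspace t B"
    and "w \<in> tensor_space s t A B"
  shows "tensor_map s t s t A B id id w = w"
  using tensor_eqI[OF assms(1,3) linear_on_tensor_map[OF assms(1-4) linear_on_id linear_on_id]
      linear_on_id _ assms(5)] tensor_map_tens[OF assms(1-4) linear_on_id linear_on_id]
  by (metis id_apply order_refl)

text \<open>Functoriality for the inclusion \<open>id \<otimes> id\<close> of the smaller tensor
  space into the larger one. It lets an operation on \<open>D\<close> be computed on the carrier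
  \<open>C\<^sub>1\<close>.\<close>

lemma tensor_map_subspace:
  assumes vs: "vector_space s" "vector_space t"
    and sub: "module.subspace s A" "module.subspace t B"
    and sub': "module.subspace s A'" "module.subspace t B'" "A \<subseteq> A'" "B \<subseteq> B'"
    and lin: "linear_on s s' A' A'' f" "linear_on t t' B' B'' g"
    and w: "w \<in> tensor_space s t A B"
  shows "tensor_map s t s' t' A' B' f g w = tensor_map s t s' t' A B f g w"
  using tensor_map_compose[OF vs sub linear_on_id[OF sub'(3)] linear_on_id[OF sub'(4)] vs
      sub'(1,2) lin w] tensor_map_id[OF vs sub w] by simp

text \<open>Inherited from additivity of pure tensors in the left factor. With its mirror image it
  splits the coproduct \<open>\<delta> + \<delta>'\<close> into its two halves.\<close>

lemma tensor_map_add_left: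
  assumes "vector_space s" "vector_space t" "module.subspace s A" "module.subspace t B"
    and "vector_space s'" "module.subspace s' A'"
    and "linear_on s s' A A' f" "linear_on s s' A A' f'" "linear_on t t' B B' g"
    and w: "w \<in> tensor_space s t A B"
  shows "tensor_map s t s' t' A B (\<lambda>x. f x + f' x) g w =
    tensor_map s t s' t' A B f g w + tensor_map s t s' t' A B f' g w"
proof -
  note l = linear_on_add[OF assms(5-8)]
  show ?thesis
    by (rule tensor_eqI[OF assms(1,3) linear_on_tensor_map[OF assms(1-4) l assms(9)]
          linear_on_add[OF vector_space_fun_scale subspace_tensor_space
            linear_on_tensor_map[OF assms(1-4,7,9)] linear_on_tensor_map[OF assms(1-4,8,9)]] _ w])
      (simp only: tensor_map_tens[OF assms(1-4) l assms(9)] tensor_map_tens[OF assms(1-4,7,9)]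
        tensor_map_tens[OF assms(1-4,8,9)] tens_add_left)
qed

lemma tensor_map_add_right:
  assumes "vector_space s" "vector_space t" "module.subspace s A" "module.subspace t B"
    and "vector_space t'" "module.subspace t' B'"
    and "linear_on s s' A A' f" "linear_on t t' B B' g" "linear_on t t' B B' g'"
    and w: "w \<in> tensor_space s t A B"
  shows "tensor_map s t s' t' A B f (\<lambda>y. g y + g' y) w =
    tensor_map s t s' t' A B f g w + tensor_map s t s' t' A B f g' w"
proof -
  note l = linear_on_add[OF assms(5,6,8,9)]
  show ?thesis
    by (rule tensor_eqI[OF assms(1,3) linear_on_tensor_map[OF assms(1-4,7) l]
          linear_on_add[OF vector_space_fun_scale subspace_tensor_space
            linear_on_tensor_map[OF assms(1-4,7,8)] linear_on_tensor_map[OF assms(1-4,7,9)]] _ w])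
      (simp only: tensor_map_tens[OF assms(1-4,7) l] tensor_map_tens[OF assms(1-4,7,8)]
        tensor_map_tens[OF assms(1-4,7,9)] tens_add_right)
qed

text \<open>Comparison with the zero map on pure tensors. It serves the second axiom on
  \<open>C\<^sub>1\<close>, where \<open>\<delta>'\<close> vanishes.\<close>

lemma tensor_map_zero_right:
  assumes "vector_space s" "vector_space t" "module.subspace s A" "module.subspace t B"
    and "linear_on s s' A A' f" "linear_on t t' B B' g" "\<And>y. y \<in> B \<Longrightarrow> g y = 0"
    and "w \<in> tensor_space s t A B"
  shows "tensor_map s t s' t' A B f g w = 0"
proof (rule tensor_eqI[OF assms(1,3) linear_on_tensor_map[OF assms(1-6)] _ _ assms(8)])
  show "linear_on fun_scale fun_scale (tensor_space s t A B) UNIV (\<lambda>_. 0)"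
    by (auto simp: linear_on_def fun_scale_def fun_eq_iff zero_fun_apply)
  show "tensor_map s t s' t' A B f g (tens s t x y) = 0" if "x \<in> A" "y \<in> B" for x y
    using that tensor_map_tens[OF assms(1-6)] by (simp add: assms(7) tens_zero_right)
qed

section \<open>The associator and its naturality\<close>

context
  fixes s :: "'k::field \<Rightarrow> 'a::ab_group_add \<Rightarrow> 'a" and Z :: "'a set"
  assumes vs: "vector_space s" and Z: "module.subspace s Z"
begin

text \<open>Justifies the inner of the two lifts in \<open>tensor_assoc\<close>, taken with
  \<open>z\<close> fixed.\<close>

private lemma inner_bilinear:
  "bilinear_on s s fun_scale Z Z UNIV (\<lambda>x y. tens s fun_scale x (tens s s y z))"
  by (auto simp: bilinear_on_def linear_on_def tens_add_left tens_add_right tens_scale_left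
      tens_scale_right)

private abbreviation (input) "inner w z \<equiv>
  tensor_lift s s fun_scale Z Z (\<lambda>x y. tens s fun_scale x (tens s s y z)) w"

private lemmas inner = tensor_lift[OF vs vs vector_space_fun_scale Z Z inner_bilinear]

text \<open>The lift is formed for one \<open>z\<close> at a time, so linearity in \<open>z\<close>
  is not built in. It follows by comparing both sides as linear maps of \<open>w\<close>;
  \<open>inner_scale\<close> is obtained likewise.\<close>

private lemma inner_add:
  assumes "w \<in> tensor_space s s Z Z"
  shows "inner w (z + z') = inner w z + inner w z'"
proof (rule tensor_eqI[OF vs Z inner(1) linear_on_add[OF vector_space_fun_scale _ inner(1) inner(1)]
      _ assms])
  show "module.subspace fun_scale (UNIV :: ('a, ('a, 'a, 'k) tensor, 'k) tensor set)"
    by (simp add: module.subspace_UNIV module_iff_vector_space vector_space_fun_scale)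
  show "inner (tens s s x y) (z + z') = inner (tens s s x y) z + inner (tens s s x y) z'"
    if "x \<in> Z" "y \<in> Z" for x y
    unfolding inner(2)[OF that] by (simp only: tens_add_right)
qed

private lemma inner_scale:
  assumes "w \<in> tensor_space s s Z Z"
  shows "inner w (s c z) = fun_scale c (inner w z)"
proof (rule tensor_eqI[OF vs Z inner(1) _ _ assms])
  show "linear_on fun_scale fun_scale (tensor_space s s Z Z) UNIV (\<lambda>w. fun_scale c (inner w z))"
    using inner(1)[of z]
    by (auto simp: linear_on_def fun_scale_def fun_eq_iff plus_fun_apply algebra_simps)
  show "inner (tens s s x y) (s c z) = fun_scale c (inner (tens s s x y) z)"
    if "x \<in> Z" "y \<in> Z" for x y
    unfolding inner(2)[OF that] by (simp only: tens_scale_right)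
qed

text \<open>Justifies the outer lift: linearity in \<open>w\<close> comes from the inner lift,
  linearity in \<open>z\<close> from the two preceding lemmas.\<close>

private lemma outer_bilinear:
  "bilinear_on fun_scale s fun_scale (tensor_space s s Z Z) Z UNIV (\<lambda>w z. inner w z)"
proof -
  interpret vector_space s by (fact vs)
  show ?thesis
    using inner(1) inner_add inner_scale subspace_add[OF Z] subspace_scale[OF Z]
    by (auto simp: bilinear_on_def linear_on_def)
qed

private lemmas outer = tensor_lift[OF vector_space_fun_scale vs vector_space_fun_scale
    subspace_tensor_space Z outer_bilinear, folded tensor_assoc_def]

lemma tensor_assoc_tens:
  assumes "x \<in> Z" "y \<in> Z" "z \<in> Z"
  shows "tensor_assoc s Z (tens fun_scale s (tens s s x y) z) = tens s fun_scale x (tens s s y z)"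
  using outer(2)[OF tens_in_tensor_space[OF assms(1,2)] assms(3)] inner(2)[OF assms(1,2)] by simp

lemma linear_on_tensor_assoc:
  "linear_on fun_scale fun_scale (tensor_space fun_scale s (tensor_space s s Z Z) Z) UNIV
    (tensor_assoc s Z)"
  by (rule outer(1))

end

text \<open>For fixed \<open>z\<close>, a linear map on the triple tensor space is linear in the
  inner tensor \<open>v\<close>, so \<open>tensor_eqI\<close> applies twice.\<close>

lemma tensor_eqI3:
  assumes vs: "vector_space s" "module.subspace s A"
    and f: "linear_on fun_scale u (tensor_space fun_scale r (tensor_space s t A B) C) U f"
    and g: "linear_on fun_scale u (tensor_space fun_scale r (tensor_space s t A B) C) V g"
    and eq: "\<And>x y z. x \<in> A \<Longrightarrow> y \<in> B \<Longrightarrow> z \<in> C \<Longrightarrow>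
      f (tens fun_scale r (tens s t x y) z) = g (tens fun_scale r (tens s t x y) z)"
    and w: "w \<in> tensor_space fun_scale r (tensor_space s t A B) C"
  shows "f w = g w"
proof (rule tensor_eqI[OF vector_space_fun_scale subspace_tensor_space f g _ w])
  fix v z
  assume v: "v \<in> tensor_space s t A B" and z: "z \<in> C"
  have "linear_on fun_scale u (tensor_space s t A B) W (\<lambda>v. h (tens fun_scale r v z))"
    if "linear_on fun_scale u (tensor_space fun_scale r (tensor_space s t A B) C) W h" for h W
    using that z
    by (auto simp: linear_on_def image_subset_iff tens_add_left tens_scale_left
        tens_in_tensor_space)
  from this[OF f] this[OF g] show "f (tens fun_scale r v z) = g (tens fun_scale r v z)"
    by (rule tensor_eqI[OF vs _ _ _ v]) (rule eq[OF _ _ z])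
qed

text \<open>Both composites are linear and send \<open>(x \<otimes> y) \<otimes> z\<close> to
  \<open>f x \<otimes> (g y \<otimes> h z)\<close>.\<close>

lemma tensor_assoc_natural:
  assumes vs: "vector_space s" and sub: "module.subspace s A" "module.subspace s Z"
    and f: "linear_on s s A Z f" and g: "linear_on s s A Z g" and h: "linear_on s s A Z h"
    and w: "w \<in> tensor_space fun_scale s (tensor_space s s A A) A"
  shows "tensor_assoc s Z (tensor_map fun_scale s fun_scale s (tensor_space s s A A) A
      (tensor_map s s s s A A f g) h w) =
    tensor_map s fun_scale s fun_scale A (tensor_space s s A A) f (tensor_map s s s s A A g h)
      (tensor_assoc s A w)"
proof -
  note fg = linear_on_tensor_map[OF vs vs sub(1,1) f g]
    and gh = linear_on_tensor_map[OF vs vs sub(1,1) g h]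
  note L = vector_space_fun_scale vs subspace_tensor_space sub(1) fg h
    and R = vs vector_space_fun_scale sub(1) subspace_tensor_space f gh
  \<comment> \<open>So far the associator is only linear into \<open>UNIV\<close>; composing
    \<open>f \<otimes> (g \<otimes> h)\<close> with it needs values in
    \<open>A \<otimes> (A \<otimes> A)\<close>. The induction runs over the outer tensor, then over
    the inner one.\<close>
  have "tensor_assoc s A v \<in> tensor_space s fun_scale A (tensor_space s s A A)"
    if "v \<in> tensor_space fun_scale s (tensor_space s s A A) A" for v
    using vector_space_fun_scale subspace_tensor_space that
  proof (induction rule: tensor_induct)
    case (pure v z)
    have lin: "linear_on fun_scale fun_scale (tensor_space s s A A) UNIV
        (\<lambda>v. tensor_assoc s A (tens fun_scale s v z))"
      using linear_on_tensor_assoc[OF vs sub(1)] pure(2)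
      by (auto simp: linear_on_def tens_add_left tens_scale_left tens_in_tensor_space)
    show ?case using vs sub(1) pure(1)
    proof (induction rule: tensor_induct)
      case (pure x y)
      then show ?case
        using tensor_assoc_tens[OF vs sub(1)] \<open>z \<in> A\<close> by (simp add: tens_in_tensor_space)
    next
      case (add v v')
      then show ?case using linear_on_plus[OF lin] by (simp add: tensor_space_add)
    next
      case zero
      show ?case using linear_on_zero[OF lin tensor_space_0] by (simp add: tensor_space_0)
    qed
  next
    case (add w w')
    then show ?case
      using linear_on_plus[OF linear_on_tensor_assoc[OF vs sub(1)]] by (simp add: tensor_space_add)
  next
    case zero
    show ?case
      using linear_on_zero[OF linear_on_tensor_assoc[OF vs sub(1)] tensor_space_0]
      by (simp add: tensor_space_0)
  qed
  then have assoc: "linear_on fun_scale fun_scale (tensor_space fun_scale s (tensor_space s s A A) A)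
      (tensor_space s fun_scale A (tensor_space s s A A)) (tensor_assoc s A)"
    using linear_on_tensor_assoc[OF vs sub(1)] by (auto simp: linear_on_def)
  let ?l = "\<lambda>w. tensor_assoc s Z (tensor_map fun_scale s fun_scale s (tensor_space s s A A) A
      (tensor_map s s s s A A f g) h w)"
  let ?r = "\<lambda>w. tensor_map s fun_scale s fun_scale A (tensor_space s s A A) f
      (tensor_map s s s s A A g h) (tensor_assoc s A w)"
  show ?thesis
  proof (rule tensor_eqI3[OF vs sub(1) linear_on_compose[OF linear_on_tensor_map[OF L]
          linear_on_tensor_assoc[OF vs sub(2)]]
        linear_on_compose[OF assoc linear_on_tensor_map[OF R]] _ w])
    fix x y z
    assume "x \<in> A" "y \<in> A" "z \<in> A"
    then show "?l (tens fun_scale s (tens s s x y) z) = ?r (tens fun_scale s (tens s s x y) z)"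
      using linear_on_in[OF f] linear_on_in[OF g] linear_on_in[OF h]
      by (simp add: tensor_map_tens[OF L] tensor_map_tens[OF R] tens_in_tensor_space
          tensor_map_tens[OF vs vs sub(1,1) f g] tensor_map_tens[OF vs vs sub(1,1) g h]
          tensor_assoc_tens[OF vs sub(1)] tensor_assoc_tens[OF vs sub(2)])
  qed
qed

text \<open>In Sweedler notation both sides are \<open>f c\<^sub>1 \<otimes> g c\<^sub>2 \<otimes> h c\<^sub>3\<close>.\<close>

lemma coassociative_tensor_map:
  assumes vs: "vector_space s" and sub: "module.subspace s A" "module.subspace s Z"
    and \<Delta>: "linear_on s fun_scale A (tensor_space s s A A) \<Delta>" and co: "coassociative s A \<Delta>"
    and f: "linear_on s s A Z f" and g: "linear_on s s A Z g" and h: "linear_on s s A Z h"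
    and c: "c \<in> A"
  shows "tensor_assoc s Z (tensor_map s s fun_scale s A A (\<lambda>x. tensor_map s s s s A A f g (\<Delta> x)) h
      (\<Delta> c)) =
    tensor_map s s s fun_scale A A f (\<lambda>x. tensor_map s s s s A A g h (\<Delta> x)) (\<Delta> c)"
proof -
  note \<Delta>c = linear_on_in[OF \<Delta> c] and i = linear_on_id[OF subset_refl]
  note fg = linear_on_tensor_map[OF vs vs sub(1,1) f g]
    and gh = linear_on_tensor_map[OF vs vs sub(1,1) g h]
  \<comment> \<open>Functoriality factors the two sides through \<open>\<Delta> \<otimes> id\<close>
    and \<open>id \<otimes> \<Delta>\<close>; naturality of the associator and coassociativity then
    join them.\<close>
  note l = tensor_map_compose[OF vs vs sub(1,1) \<Delta> i vector_space_fun_scale vs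
      subspace_tensor_space sub(1) fg h \<Delta>c]
    and r = tensor_map_compose[OF vs vs sub(1,1) i \<Delta> vs vector_space_fun_scale
      sub(1) subspace_tensor_space f gh \<Delta>c]
  have mem: "map_id s fun_scale A \<Delta> (\<Delta> c) \<in> tensor_space fun_scale s (tensor_space s s A A) A"
    by (rule linear_on_in[OF linear_on_tensor_map[OF vs vs sub(1,1) \<Delta> i] \<Delta>c])
  have "id_map s fun_scale A \<Delta> (\<Delta> c) = tensor_assoc s A (map_id s fun_scale A \<Delta> (\<Delta> c))"
    using co c by (simp add: coassociative_def)
  then show ?thesis using tensor_assoc_natural[OF vs sub f g h mem] l r by simp
qed

section \<open>The dendriform axioms on \<open>D\<close> and coassociativity of the sum\<close>

theorem theorem2p23:
  fixes scale :: "'k::real_normed_field \<Rightarrow> 'v::ab_group_add \<Rightarrow> 'v"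
    and C\<^sub>1 C\<^sub>2 D :: "'v set"
    and \<Delta>\<^sub>1 \<Delta>\<^sub>2 \<delta> \<delta>' :: "'v \<Rightarrow> ('v, 'v, 'k) tensor"
    and \<epsilon>\<^sub>1 \<epsilon>\<^sub>2 :: "'v \<Rightarrow> 'k"
    and \<Phi> :: "'v \<Rightarrow> 'v"
  assumes "vector_space scale"
    and "countable_dim scale C\<^sub>1" and "countable_dim scale C\<^sub>2"
    and "coalgebra scale C\<^sub>1 \<Delta>\<^sub>1 \<epsilon>\<^sub>1" and "coalgebra scale C\<^sub>2 \<Delta>\<^sub>2 \<epsilon>\<^sub>2"
    and "channel_map scale C\<^sub>1 \<Delta>\<^sub>1 \<epsilon>\<^sub>1 C\<^sub>2 \<Delta>\<^sub>2 \<epsilon>\<^sub>2 \<Phi>"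
    and "D = {x + y | x y. x \<in> C\<^sub>1 \<and> y \<in> C\<^sub>2}"
    and "linear_on scale fun_scale D (tensor_space scale scale D D) \<delta>"
    and "linear_on scale fun_scale D (tensor_space scale scale D D) \<delta>'"
    and "\<forall>c\<in>C\<^sub>1. \<delta> c = \<Delta>\<^sub>1 c"
    and "\<forall>c\<in>C\<^sub>1. \<delta> (\<Phi> c) = id_map scale scale C\<^sub>1 \<Phi> (\<Delta>\<^sub>1 c)"
    and "\<forall>c\<in>C\<^sub>1. \<delta>' c = 0"
    and "\<forall>c\<in>C\<^sub>1. \<delta>' (\<Phi> c) = map_id scale scale C\<^sub>1 \<Phi> (\<Delta>\<^sub>1 c)"
  shows "coassociative scale D (\<lambda>x. \<delta> x + \<delta>' x) \<and> dendriform_coalgebra scale D \<delta> \<delta>'"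
proof -
  note vs = assms(1) and F = vector_space_fun_scale and D_def = assms(7)
    and \<delta> = assms(8) and \<delta>' = assms(9)
    and \<delta>_C = assms(10) and \<delta>_\<Phi> = assms(11) and \<delta>'_C = assms(12) and \<delta>'_\<Phi> = assms(13)
  interpret vector_space scale by fact
  let ?T = "tensor_space scale scale D D"
  let ?t = "tensor_map scale scale scale scale C\<^sub>1 C\<^sub>1"
  have C: "subspace C\<^sub>1" and C2: "subspace C\<^sub>2"
    and \<Delta>: "linear_on scale fun_scale C\<^sub>1 (tensor_space scale scale C\<^sub>1 C\<^sub>1) \<Delta>\<^sub>1"
    and co: "coassociative scale C\<^sub>1 \<Delta>\<^sub>1"
    using assms(4,5) by (auto simp: coalgebra_def)
  have \<Phi>2: "linear_on scale scale C\<^sub>1 C\<^sub>2 \<Phi>" and onto: "\<Phi> ` C\<^sub>1 = C\<^sub>2"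
    using assms(6) by (auto simp: channel_map_def bij_betw_def)
  have D: "subspace D" unfolding D_def by (rule subspace_sums[OF C C2])
  have CD: "C\<^sub>1 \<subseteq> D" and C2D: "C\<^sub>2 \<subseteq> D"
    unfolding D_def using subspace_0[OF C] subspace_0[OF C2]
    by (force intro: exI[of _ 0])+
  have \<Phi>: "linear_on scale scale C\<^sub>1 D \<Phi>" by (rule linear_on_mono[OF \<Phi>2 subset_refl C2D])
  have i: "linear_on scale scale C\<^sub>1 D id" by (rule linear_on_id[OF CD])
  have iD: "linear_on scale scale D D id" by (rule linear_on_id[OF subset_refl])
  have sum: "linear_on scale fun_scale D ?T (\<lambda>x. \<delta> x + \<delta>' x)"
    by (rule linear_on_add[OF F subspace_tensor_space \<delta> \<delta>'])
  have sum': "linear_on scale fun_scale D ?T (\<lambda>x. \<delta>' x + \<delta> x)"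
    by (rule linear_on_add[OF F subspace_tensor_space \<delta>' \<delta>])
  note \<Delta>_in = linear_on_in[OF \<Delta>]
  \<comment> \<open>Inserting \<open>id \<otimes> id\<close> gives the terms without
    \<open>\<Phi>\<close> the same shape as the others, so the rules below cover them too.\<close>
  have \<Delta>_id: "\<Delta>\<^sub>1 c = ?t id id (\<Delta>\<^sub>1 c)" if "c \<in> C\<^sub>1" for c
    using tensor_map_id[OF vs vs C C \<Delta>_in[OF that]] by simp
  \<comment> \<open>Absorbs \<open>F \<otimes> id\<close> on \<open>D\<close> into a tensor map on
    \<open>C\<^sub>1\<close>. \<open>F'\<close> is the known expression for \<open>F\<close> after
    \<open>f\<close>, such as a prescribed coproduct of \<open>\<Phi> x\<close>.
    \<open>push_r\<close> is the mirror image.\<close>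
  have push_l: "map_id scale fun_scale D F (?t f g (\<Delta>\<^sub>1 c)) =
      tensor_map scale scale fun_scale scale C\<^sub>1 C\<^sub>1 F' g (\<Delta>\<^sub>1 c)"
    if F: "linear_on scale fun_scale D ?T F" and f: "linear_on scale scale C\<^sub>1 D f"
      and g: "linear_on scale scale C\<^sub>1 D g" and c: "c \<in> C\<^sub>1"
      and eq: "\<forall>x\<in>C\<^sub>1. F (f x) = F' x" for F F' f g c
    unfolding tensor_map_compose[OF vs vs C C f g vs vs D D F iD \<Delta>_in[OF c]]
    by (rule tensor_map_cong[OF vs vs C C linear_on_compose[OF f F] linear_on_compose[OF g iD]
          _ _ \<Delta>_in[OF c]]) (simp_all add: eq)
  have push_r: "id_map scale fun_scale D F (?t f g (\<Delta>\<^sub>1 c)) =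
      tensor_map scale scale scale fun_scale C\<^sub>1 C\<^sub>1 f F' (\<Delta>\<^sub>1 c)"
    if F: "linear_on scale fun_scale D ?T F" and f: "linear_on scale scale C\<^sub>1 D f"
      and g: "linear_on scale scale C\<^sub>1 D g" and c: "c \<in> C\<^sub>1"
      and eq: "\<forall>x\<in>C\<^sub>1. F (g x) = F' x" for F F' f g c
    unfolding tensor_map_compose[OF vs vs C C f g vs vs D D iD F \<Delta>_in[OF c]]
    by (rule tensor_map_cong[OF vs vs C C linear_on_compose[OF f iD] linear_on_compose[OF g F]
          _ _ \<Delta>_in[OF c]]) (simp_all add: eq)
  note sweedler = coassociative_tensor_map[OF vs C D \<Delta> co]
  note lin_l = linear_on_tensor_map[OF vs vs D D _ iD]
    and lin_r = linear_on_tensor_map[OF vs vs D D iD]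
  have assoc: "linear_on fun_scale fun_scale (tensor_space fun_scale scale ?T D) UNIV
      (tensor_assoc scale D)"
    by (rule linear_on_tensor_assoc[OF vs D])
  \<comment> \<open>A decomposition \<open>z = x + \<Phi> y\<close> exists because
    \<open>\<Phi>\<close> is onto \<open>C\<^sub>2\<close>. It may fail to be unique, which is
    harmless as \<open>P\<close> and \<open>Q\<close> are already linear on all of
    \<open>D\<close>.\<close>
  have extend: "P z = Q z"
    if "linear_on scale fun_scale D U P" "linear_on scale fun_scale D V Q"
      "\<And>c. c \<in> C\<^sub>1 \<Longrightarrow> P c = Q c" "\<And>c. c \<in> C\<^sub>1 \<Longrightarrow> P (\<Phi> c) = Q (\<Phi> c)" "z \<in> D"
    for P Q :: "'v \<Rightarrow> ('v, ('v, 'v, 'k) tensor, 'k) tensor" and U V z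
  proof -
    obtain x y where z: "z = x + \<Phi> y" "x \<in> C\<^sub>1" "y \<in> C\<^sub>1"
      using \<open>z \<in> D\<close> onto unfolding D_def by blast
    then have "x \<in> D" "\<Phi> y \<in> D" using CD linear_on_in[OF \<Phi>] by auto
    then show ?thesis
      using that z linear_on_plus[OF that(1)] linear_on_plus[OF that(2)] by simp
  qed
  have sum_id: "\<forall>c\<in>C\<^sub>1. \<delta> (id c) + \<delta>' (id c) = ?t id id (\<Delta>\<^sub>1 c)"
    and sum'_id: "\<forall>c\<in>C\<^sub>1. \<delta>' (id c) + \<delta> (id c) = ?t id id (\<Delta>\<^sub>1 c)"
    and \<delta>_id: "\<forall>c\<in>C\<^sub>1. \<delta> (id c) = ?t id id (\<Delta>\<^sub>1 c)"
    using \<delta>_C \<delta>'_C \<Delta>_id by simp_all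

  have ax1: "id_map scale fun_scale D (\<lambda>x. \<delta> x + \<delta>' x) (\<delta>' z)
      = tensor_assoc scale D (map_id scale fun_scale D \<delta>' (\<delta>' z))" if "z \<in> D" for z
  proof (rule extend[OF linear_on_compose[OF \<delta>' lin_r[OF sum]]
        linear_on_compose[OF linear_on_compose[OF \<delta>' lin_l[OF \<delta>']] assoc] _ _ that])
    fix c
    assume c: "c \<in> C\<^sub>1"
    \<comment> \<open>Both sides vanish with \<open>\<delta>' c\<close>.\<close>
    show "id_map scale fun_scale D (\<lambda>x. \<delta> x + \<delta>' x) (\<delta>' c)
        = tensor_assoc scale D (map_id scale fun_scale D \<delta>' (\<delta>' c))"
      using linear_on_zero[OF lin_r[OF sum] tensor_space_0]
        linear_on_zero[OF lin_l[OF \<delta>'] tensor_space_0] linear_on_zero[OF assoc tensor_space_0]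
      by (simp add: bspec[OF \<delta>'_C c])
    \<comment> \<open>The common value is
      \<open>\<Phi> c\<^sub>1 \<otimes> c\<^sub>2 \<otimes> c\<^sub>3\<close>.\<close>
    show "id_map scale fun_scale D (\<lambda>x. \<delta> x + \<delta>' x) (\<delta>' (\<Phi> c))
        = tensor_assoc scale D (map_id scale fun_scale D \<delta>' (\<delta>' (\<Phi> c)))"
      unfolding bspec[OF \<delta>'_\<Phi> c] push_l[OF \<delta>' \<Phi> i c \<delta>'_\<Phi>]
        push_r[OF sum \<Phi> i c sum_id]
      by (rule sweedler[OF \<Phi> i i c, symmetric])
  qed
  have ax2: "id_map scale fun_scale D \<delta>' (\<delta> z)
      = tensor_assoc scale D (map_id scale fun_scale D \<delta> (\<delta>' z))" if "z \<in> D" for z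
  proof (rule extend[OF linear_on_compose[OF \<delta> lin_r[OF \<delta>']]
        linear_on_compose[OF linear_on_compose[OF \<delta>' lin_l[OF \<delta>]] assoc] _ _ that])
    fix c
    assume c: "c \<in> C\<^sub>1"
    \<comment> \<open>The right side of the axiom vanishes with \<open>\<delta>' c\<close>. On the
      left, \<open>\<Delta>\<^sub>1 c\<close> lies in \<open>C\<^sub>1 \<otimes> C\<^sub>1\<close>,
      and after shrinking the carrier \<open>\<delta>'\<close> is zero throughout.\<close>
    have "id_map scale fun_scale D \<delta>' (\<Delta>\<^sub>1 c) = id_map scale fun_scale C\<^sub>1 \<delta>' (\<Delta>\<^sub>1 c)"
      by (rule tensor_map_subspace[OF vs vs C C D D CD CD iD \<delta>' \<Delta>_in[OF c]])
    also have "\<dots> = 0"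
      by (rule tensor_map_zero_right[OF vs vs C C i linear_on_mono[OF \<delta>' CD subset_refl]
            bspec[OF \<delta>'_C] \<Delta>_in[OF c]])
    finally show "id_map scale fun_scale D \<delta>' (\<delta> c)
        = tensor_assoc scale D (map_id scale fun_scale D \<delta> (\<delta>' c))"
      using linear_on_zero[OF lin_l[OF \<delta>] tensor_space_0] linear_on_zero[OF assoc tensor_space_0]
      by (simp add: bspec[OF \<delta>_C c] bspec[OF \<delta>'_C c])
    \<comment> \<open>The common value is
      \<open>c\<^sub>1 \<otimes> \<Phi> c\<^sub>2 \<otimes> c\<^sub>3\<close>.\<close>
    show "id_map scale fun_scale D \<delta>' (\<delta> (\<Phi> c))
        = tensor_assoc scale D (map_id scale fun_scale D \<delta> (\<delta>' (\<Phi> c)))"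
      unfolding bspec[OF \<delta>_\<Phi> c] bspec[OF \<delta>'_\<Phi> c] push_l[OF \<delta> \<Phi> i c \<delta>_\<Phi>]
        push_r[OF \<delta>' i \<Phi> c \<delta>'_\<Phi>]
      by (rule sweedler[OF i \<Phi> i c, symmetric])
  qed
  have ax3: "tensor_assoc scale D (map_id scale fun_scale D (\<lambda>x. \<delta>' x + \<delta> x) (\<delta> z))
      = id_map scale fun_scale D \<delta> (\<delta> z)" if "z \<in> D" for z
  proof (rule extend[OF linear_on_compose[OF linear_on_compose[OF \<delta> lin_l[OF sum']] assoc]
        linear_on_compose[OF \<delta> lin_r[OF \<delta>]] _ _ that])
    fix c
    assume c: "c \<in> C\<^sub>1"
    \<comment> \<open>The right factor stays open: \<open>id\<close> serves the case
      \<open>c\<close>, with common value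
      \<open>c\<^sub>1 \<otimes> c\<^sub>2 \<otimes> c\<^sub>3\<close>, and \<open>\<Phi>\<close>
      the case \<open>\<Phi> c\<close>, with
      \<open>c\<^sub>1 \<otimes> c\<^sub>2 \<otimes> \<Phi> c\<^sub>3\<close>.\<close>
    note l = push_l[OF sum' i _ c sum'_id]
    have \<delta>c: "\<delta> c = ?t id id (\<Delta>\<^sub>1 c)" using bspec[OF \<delta>_C c] \<Delta>_id[OF c] by (rule trans)
    show "tensor_assoc scale D (map_id scale fun_scale D (\<lambda>x. \<delta>' x + \<delta> x) (\<delta> c))
        = id_map scale fun_scale D \<delta> (\<delta> c)"
      unfolding \<delta>c l[OF i]
        push_r[OF \<delta> i i c \<delta>_id]
      by (rule sweedler[OF i i i c])
    show "tensor_assoc scale D (map_id scale fun_scale D (\<lambda>x. \<delta>' x + \<delta> x) (\<delta> (\<Phi> c)))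
        = id_map scale fun_scale D \<delta> (\<delta> (\<Phi> c))"
      unfolding bspec[OF \<delta>_\<Phi> c] l[OF \<Phi>] push_r[OF \<delta> i \<Phi> c \<delta>_\<Phi>]
      by (rule sweedler[OF i i \<Phi> c])
  qed
  have "coassociative scale D (\<lambda>x. \<delta> x + \<delta>' x)"
    unfolding coassociative_def
  proof
    fix z
    assume z: "z \<in> D"
    note w = linear_on_in[OF \<delta> z] and w' = linear_on_in[OF \<delta>' z]
    let ?a = "tensor_assoc scale D"
    let ?l = "map_id scale fun_scale D" and ?r = "id_map scale fun_scale D"
    \<comment> \<open>Only the term in \<open>\<delta> z\<close> is split, because the first axiom
      has the whole sum acting on \<open>\<delta>' z\<close>.\<close>
    have "?r (\<lambda>x. \<delta> x + \<delta>' x) (\<delta> z + \<delta>' z) =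
        ?r \<delta> (\<delta> z) + ?r \<delta>' (\<delta> z) + ?r (\<lambda>x. \<delta> x + \<delta>' x) (\<delta>' z)"
      unfolding linear_on_plus[OF lin_r[OF sum] w w']
        tensor_map_add_right[OF vs vs D D F subspace_tensor_space iD \<delta> \<delta>' w] ..
    \<comment> \<open>From left to right the terms are replaced by the third, second and first
      axiom. Commutativity reconciles \<open>\<delta>' x + \<delta> x\<close> in the third axiom
      with \<open>\<delta> x + \<delta>' x\<close>.\<close>
    also have "\<dots> = ?a (?l (\<lambda>x. \<delta> x + \<delta>' x) (\<delta> z)) + (?a (?l \<delta> (\<delta>' z)) + ?a (?l \<delta>' (\<delta>' z)))"
      unfolding ax1[OF z] ax2[OF z] ax3[OF z, symmetric]
      by (simp only: add.assoc add.commute[of "\<delta> _"])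
    \<comment> \<open>The last two terms recombine into the sum acting on the left factor of
      \<open>\<delta>' z\<close>.\<close>
    also have "\<dots> = ?a (?l (\<lambda>x. \<delta> x + \<delta>' x) (\<delta> z) + ?l (\<lambda>x. \<delta> x + \<delta>' x) (\<delta>' z))"
      unfolding tensor_map_add_left[OF vs vs D D F subspace_tensor_space \<delta> \<delta>' iD w']
        linear_on_plus[OF assoc linear_on_in[OF lin_l[OF \<delta>] w'] linear_on_in[OF lin_l[OF \<delta>'] w'],
          symmetric]
      by (rule linear_on_plus[OF assoc linear_on_in[OF lin_l[OF sum] w]
            tensor_space_add[OF linear_on_in[OF lin_l[OF \<delta>] w'] linear_on_in[OF lin_l[OF \<delta>'] w']],
            symmetric])
    also have "\<dots> = ?a (?l (\<lambda>x. \<delta> x + \<delta>' x) (\<delta> z + \<delta>' z))"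
      unfolding linear_on_plus[OF lin_l[OF sum] w w'] ..
    finally show "?r (\<lambda>x. \<delta> x + \<delta>' x) (\<delta> z + \<delta>' z)
      = ?a (?l (\<lambda>x. \<delta> x + \<delta>' x) (\<delta> z + \<delta>' z))" .
  qed
  with D \<delta> \<delta>' ax1 ax2 ax3 show ?thesis by (auto simp: dendriform_coalgebra_def)
qed

end
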